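(* Let $0\le\beta<1$, let $f$ be a continuous function on $[0,\infty)$, and let $[a,b]\subset[0,\infty)$. Then, as $n\to\infty$, the sequence $\{P_n^{\beta}(f,x)\}$ converges to $f(x)$ uniformly for $x\in[a,b]$.
   Context: For $0\le\beta<1$, a positive integer $n$, an integer $k\ge 0$ and $x\in[0,\infty)$, let $$L_{n,k}^{(\beta)}(x)=\frac{nx(nx+k\beta)^{k-1}}{k!}\,e^{-(nx+k\beta)},$$ where for $k=0$ this is understood as $L_{n,0}^{(\beta)}(x)=e^{-nx}$. Write $\langle f,g\rangle=\int_0^\infty f(t)g(t)\,dt$. The generalized Phillips type operators are $$P_n^{\beta}(f,x)=\sum_{k=1}^{\infty}\frac{\langle L_{n,k-1}^{(\beta)}(t),f(t)\rangle}{\langle L_{n,k-1}^{(\beta)}(t),1\rangle}\,L_{n,k}^{(\beta)}(x)+e^{-nx}f(0),\qquad x\in[0,\infty),$$ for functions $f$ for which the right-hand side is defined. *)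

theory Defs
  imports "HOL-Analysis.Analysis"
begin

definition jain_basis :: "real \<Rightarrow> nat \<Rightarrow> nat \<Rightarrow> real \<Rightarrow> real" where
  "jain_basis \<beta> n k x =
     (if k = 0 then exp (- (real n * x))
      else real n * x * (real n * x + real k * \<beta>) ^ (k - 1) / fact k
             * exp (- (real n * x + real k * \<beta>)))"

definition half_line_inner :: "(real \<Rightarrow> real) \<Rightarrow> (real \<Rightarrow> real) \<Rightarrow> real" where
  "half_line_inner f g = (LBINT t:{0..}. f t * g t)"

text \<open>In the next two definitions the series over \<open>k \<ge> 1\<close> is reindexed to start at \<open>0\<close>.\<close>

definition phillips_term ::
    "real \<Rightarrow> nat \<Rightarrow> (real \<Rightarrow> real) \<Rightarrow> real \<Rightarrow> nat \<Rightarrow> real" where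
  "phillips_term \<beta> n f x k =
     half_line_inner (jain_basis \<beta> n k) f / half_line_inner (jain_basis \<beta> n k) (\<lambda>_. 1)
       * jain_basis \<beta> n (Suc k) x"

definition phillips_op :: "real \<Rightarrow> nat \<Rightarrow> (real \<Rightarrow> real) \<Rightarrow> real \<Rightarrow> real" where
  "phillips_op \<beta> n f x = (\<Sum>k. phillips_term \<beta> n f x k) + exp (- (real n * x)) * f 0"

text \<open>
  Integrals and series are total functions here, so meaningfulness of the expression
  defining \<open>phillips_op \<beta> n f x\<close> is a separate predicate. The denominators need no clause: for
  \<open>0 \<le> \<beta>\<close> and \<open>n > 0\<close> they are convergent integrals of nonnegative, not identically vanishing,
  continuous functions.
\<close>

definition phillips_defined :: "real \<Rightarrow> nat \<Rightarrow> (real \<Rightarrow> real) \<Rightarrow> real \<Rightarrow> bool" where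
  "phillips_defined \<beta> n f x \<longleftrightarrow>
     (\<forall>k. set_integrable lborel {0..} (\<lambda>t. jain_basis \<beta> n k t * f t)) \<and>
     summable (phillips_term \<beta> n f x)"

end

(*
  With p_k(y) = L_k(y/n), the Jain basis satisfies p_{k+1}'(y) = p_k(y + b) - p_{k+1}(y), where
  b is the parameter beta. Comparison for the differential inequality g' + g <= h' + h then gives,
  by induction on the number of summands, sum p_k = 1, a second moment of order y about y, and a
  generating function bound sum q^k p_k(y) <= exp (l y) with some q > 1. On the integral side the
  normalised p_k has mean square deviation O(k + 1) from k (1 - b), by integrating the derivative
  of a suitable polynomial multiple of (s + k b)^k exp (-s).

  No growth of f is assumed, but definedness at a single index N makes exp (-N t) f(t) integrable
  (this is the term k = 0). Tilting p_k by q then bounds the contribution of t > R to the k-th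
  coefficient by q^k exp (-c n R) up to a factor n, and for large R this beats the factor
  exp (l n x) produced by the generating function.
*)

theory Submission
  imports Defs "HOL-Probability.Distributions" "HOL-Real_Asymp.Real_Asymp"
begin

section \<open>Generalised Poisson weights and their shifted differential equation\<close>

definition gpois :: "real \<Rightarrow> nat \<Rightarrow> real \<Rightarrow> real" where
  "gpois b k y = (if k = 0 then exp (- y)
     else y * (y + real k * b) ^ (k - 1) / fact k * exp (- (y + real k * b)))"

lemma jain_basis_eq_gpois: "jain_basis \<beta> n k x = gpois \<beta> k (real n * x)"
  by (simp add: jain_basis_def gpois_def)

lemma gpois_nonneg: "0 \<le> b \<Longrightarrow> 0 \<le> y \<Longrightarrow> 0 \<le> gpois b k y"
  by (simp add: gpois_def)

lemma gpois_0 [simp]: "gpois b 0 y = exp (- y)"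
  by (simp add: gpois_def)

lemma gpois_Suc_at_0 [simp]: "gpois b (Suc k) 0 = 0"
  by (simp add: gpois_def)

lemma has_real_derivative_gpois_Suc:
  "(gpois b (Suc k) has_real_derivative gpois b k (y + b) - gpois b (Suc k) y) (at y)"
proof (cases k)
  case 0
  have eq: "gpois b (Suc k) = (\<lambda>y. y * exp (- (y + b)))"
    using 0 by (auto simp: gpois_def)
  have d: "((\<lambda>y. y * exp (- (y + b))) has_real_derivative exp (- (y + b)) - y * exp (- (y + b))) (at y)"
    by (rule derivative_eq_intros refl | simp)+
  have "gpois b k (y + b) - gpois b (Suc k) y = exp (- (y + b)) - y * exp (- (y + b))"
    by (simp add: 0 gpois_def)
  then show ?thesis using d unfolding eq by metis
next
  case (Suc j)
  have eq: "gpois b (Suc k) = (\<lambda>y. y * (y + real (Suc k) * b) ^ k / fact (Suc k) * exp (- (y + real (Suc k) * b)))"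
    by (auto simp: gpois_def)
  define c u where "c = real (Suc k) * b" and "u = y + c"
  have P: "((\<lambda>y. y * (y + c) ^ k) has_real_derivative u ^ k + y * (real k * u ^ (k - 1))) (at y)"
    unfolding u_def by (auto intro!: derivative_eq_intros)
  have E: "((\<lambda>y. exp (- (y + c))) has_real_derivative - exp (- u)) (at y)"
    unfolding u_def by (rule derivative_eq_intros refl | simp)+
  \<comment> \<open>Since u = y + (k + 1) b, one has u + k y = (k + 1) (y + b). The factor k + 1
    then cancels against \<open>fact (Suc k)\<close>, and u = (y + b) + k b is already the base
    occurring in \<open>gpois b k (y + b)\<close>.\<close>
  have "u ^ k + y * (real k * u ^ (k - 1)) = real (Suc k) * ((y + b) * u ^ (k - 1))"
    unfolding Suc u_def c_def by (simp add: algebra_simps)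
  then have "(u ^ k + y * (real k * u ^ (k - 1))) / fact (Suc k) = (y + b) * u ^ (k - 1) / fact k"
    by (simp add: fact_Suc del: of_nat_Suc)
  moreover have "gpois b k (y + b) = (y + b) * u ^ (k - 1) / fact k * exp (- u)"
    by (simp add: Suc gpois_def u_def c_def algebra_simps)
  ultimately have "(u ^ k + y * (real k * u ^ (k - 1))) / fact (Suc k) * exp (- u)
      + - exp (- u) * (y * (y + c) ^ k / fact (Suc k)) = gpois b k (y + b) - gpois b (Suc k) y"
    by (simp add: eq u_def c_def)
  then show ?thesis
    using DERIV_mult[OF DERIV_cdivide[OF P, of "fact (Suc k)"] E]
    unfolding eq c_def[symmetric] u_def[symmetric] by metis
qed

text \<open>Adding the sum to its own derivative leaves a sum with one summand fewer, with weights
  shifted by one and argument \<open>y + b\<close>. This drives the inductions on \<open>K\<close>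
  below, which must therefore keep \<open>y\<close> arbitrary.\<close>

lemma has_real_derivative_gpois_weighted_sum:
  "((\<lambda>y. \<Sum>k\<le>K. w k * gpois b k y) has_real_derivative
     (\<Sum>k<K. w (Suc k) * gpois b k (y + b)) - (\<Sum>k\<le>K. w k * gpois b k y)) (at y)"
proof (induction K)
  case 0
  show ?case by (auto intro!: derivative_eq_intros)
next
  case (Suc K)
  have "((\<lambda>y. (\<Sum>k\<le>K. w k * gpois b k y) + w (Suc K) * gpois b (Suc K) y) has_real_derivative
     ((\<Sum>k<K. w (Suc k) * gpois b k (y + b)) - (\<Sum>k\<le>K. w k * gpois b k y))
       + w (Suc K) * (gpois b K (y + b) - gpois b (Suc K) y)) (at y)"
    by (intro DERIV_add Suc DERIV_cmult has_real_derivative_gpois_Suc)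
  then show ?case by (simp add: algebra_simps)
qed

lemma gpois_weighted_sum_at_0: "(\<Sum>k\<le>K. w k * gpois b k 0) = w 0"
  by (induction K) auto

text \<open>Multiplying by \<open>exp y\<close> turns the hypothesis into monotonicity of \<open>(h - g) exp\<close>.\<close>

lemma ode_comparison:
  fixes g h :: "real \<Rightarrow> real"
  assumes g: "\<And>y. 0 \<le> y \<Longrightarrow> (g has_real_derivative g' y) (at y)"
    and h: "\<And>y. 0 \<le> y \<Longrightarrow> (h has_real_derivative h' y) (at y)"
    and le: "\<And>y. 0 \<le> y \<Longrightarrow> g' y + g y \<le> h' y + h y"
    and init: "g 0 \<le> h 0" and y: "0 \<le> y"
  shows "g y \<le> h y"
proof -
  have "(h 0 - g 0) * exp 0 \<le> (h y - g y) * exp y"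
  proof (rule DERIV_nonneg_imp_nondecreasing [OF y])
    fix x :: real assume x: "0 \<le> x" "x \<le> y"
    have "((\<lambda>x. (h x - g x) * exp x) has_real_derivative
        (h' x - g' x) * exp x + exp x * (h x - g x)) (at x)"
      using x by (auto intro!: derivative_eq_intros g h)
    moreover have "0 \<le> (h' x - g' x + h x - g x) * exp x"
      using le[of x] x by simp
    ultimately show "\<exists>z. ((\<lambda>x. (h x - g x) * exp x) has_real_derivative z) (at x) \<and> 0 \<le> z"
      by (intro exI conjI) (auto simp: algebra_simps)
  qed
  then have "0 \<le> (h y - g y) * exp y" using init by simp
  then show ?thesis by (simp add: zero_le_mult_iff)
qed

section \<open>Mass, generating function and second moment of the weights\<close>

lemma gpois_sum_le_1:
  assumes "0 \<le> b" "0 \<le> y"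
  shows "(\<Sum>k\<le>K. gpois b k y) \<le> 1"
  using assms(2)
proof (induction K arbitrary: y)
  case (Suc K)
  note IH = Suc.IH
  show ?case
  \<comment> \<open>The constant 1 is a supersolution: here g' + g is the shorter sum at
    \<open>y + b\<close>, which the induction hypothesis bounds by 1.\<close>
  proof (rule ode_comparison[where h = "\<lambda>_. 1" and h' = "\<lambda>_. 0" and
        g' = "\<lambda>y. (\<Sum>k<Suc K. gpois b k (y + b)) - (\<Sum>k\<le>Suc K. gpois b k y)", OF _ _ _ _ Suc.prems])
    fix y :: real assume y: "0 \<le> y"
    show "((\<lambda>y. \<Sum>k\<le>Suc K. gpois b k y) has_real_derivative
        (\<Sum>k<Suc K. gpois b k (y + b)) - (\<Sum>k\<le>Suc K. gpois b k y)) (at y)"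
      using has_real_derivative_gpois_weighted_sum[of "\<lambda>_. 1" b "Suc K" y]
      by (simp only: mult_1)
    show "(\<Sum>k<Suc K. gpois b k (y + b)) - (\<Sum>k\<le>Suc K. gpois b k y) + (\<Sum>k\<le>Suc K. gpois b k y) \<le> 0 + 1"
      using IH[of "y + b"] y assms(1) by (simp add: lessThan_Suc_atMost)
  qed (use gpois_weighted_sum_at_0[of "\<lambda>_. 1" b "Suc K"] in auto)
qed auto

text \<open>The relation between q and l says precisely that exp (l y) is a supersolution: shifting
  the weights produces a factor q, shifting the argument a factor exp (l b), and together they must
  not exceed the factor 1 + l coming from h' + h.\<close>

lemma gpois_sum_power_le:
  assumes "0 \<le> b" "0 \<le> q" "0 \<le> l" "q * exp (l * b) \<le> 1 + l" "0 \<le> y"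
  shows "(\<Sum>k\<le>K. q ^ k * gpois b k y) \<le> exp (l * y)"
  using assms(5)
proof (induction K arbitrary: y)
  case 0
  have "0 \<le> l * y" using assms(3) 0 by simp
  then have "- y \<le> l * y" using 0 by linarith
  then show ?case by simp
next
  case (Suc K)
  note IH = Suc.IH
  show ?case
  proof (rule ode_comparison[where h = "\<lambda>y. exp (l * y)" and h' = "\<lambda>y. l * exp (l * y)" and
        g' = "\<lambda>y. (\<Sum>k<Suc K. q ^ Suc k * gpois b k (y + b)) - (\<Sum>k\<le>Suc K. q ^ k * gpois b k y)", OF _ _ _ _ Suc.prems])
    fix y :: real assume y: "0 \<le> y"
    show "((\<lambda>y. \<Sum>k\<le>Suc K. q ^ k * gpois b k y) has_real_derivative
        (\<Sum>k<Suc K. q ^ Suc k * gpois b k (y + b)) - (\<Sum>k\<le>Suc K. q ^ k * gpois b k y)) (at y)"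
      by (rule has_real_derivative_gpois_weighted_sum)
    have "(\<Sum>k<Suc K. q ^ Suc k * gpois b k (y + b)) = q * (\<Sum>k\<le>K. q ^ k * gpois b k (y + b))"
      by (simp add: lessThan_Suc_atMost sum_distrib_left mult.assoc)
    also have "\<dots> \<le> q * exp (l * (y + b))"
      using IH[of "y + b"] y assms(1,2) by (intro mult_left_mono) auto
    also have "\<dots> = (q * exp (l * b)) * exp (l * y)"
      by (simp add: distrib_left exp_add)
    also have "\<dots> \<le> (1 + l) * exp (l * y)"
      using assms(4) by (intro mult_right_mono) auto
    finally show "(\<Sum>k<Suc K. q ^ Suc k * gpois b k (y + b)) - (\<Sum>k\<le>Suc K. q ^ k * gpois b k y)
        + (\<Sum>k\<le>Suc K. q ^ k * gpois b k y) \<le> l * exp (l * y) + exp (l * y)"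
      by (simp add: algebra_simps)
  qed (use gpois_weighted_sum_at_0[of "\<lambda>k. q ^ k" b "Suc K"] in
      \<open>auto intro!: derivative_eq_intros\<close>)
qed

text \<open>With h_a(y) = (y - a)^2 + y / (1 - b), this is h_a'(y) + h_a(y) = h_c(y + b) for c = a -
  (1 - b). The second moment bound thus satisfies the shifted equation with equality.\<close>

lemma second_moment_bound_ode:
  fixes a b y :: real
  assumes "b < 1"
  shows "2 * (y - a) + 1 / (1 - b) + ((y - a)\<^sup>2 + y / (1 - b)) = (y - a + 1)\<^sup>2 + (y + b) / (1 - b)"
proof -
  have "(y + b) / (1 - b) = y / (1 - b) + 1 / (1 - b) - 1"
    using assms by (simp add: field_simps)
  then show ?thesis by (simp add: power2_eq_square algebra_simps)
qed

lemma gpois_second_moment_partial: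
  assumes "0 \<le> b" "b < 1" "0 \<le> y"
  shows "(\<Sum>k\<le>K. (real k * (1 - b) - a)\<^sup>2 * gpois b k y) \<le> (y - a)\<^sup>2 + y / (1 - b)"
  using assms(3)
proof (induction K arbitrary: y a)
  case 0
  \<comment> \<open>For a single summand g' + g = 0, so the comparison needs only that h' + h is
    nonnegative.\<close>
  have "(\<Sum>k\<le>(0::nat). (real k * (1 - b) - a)\<^sup>2 * gpois b k y) \<le> (y - a)\<^sup>2 + y / (1 - b)"
  proof (rule ode_comparison[where h = "\<lambda>y. (y - a)\<^sup>2 + y / (1 - b)" and
        h' = "\<lambda>y. 2 * (y - a) + 1 / (1 - b)" and g' = "\<lambda>y. - (a\<^sup>2 * exp (- y))", OF _ _ _ _ 0])
    fix y :: real assume y: "0 \<le> y"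
    have "2 * (y - a) + 1 / (1 - b) + ((y - a)\<^sup>2 + y / (1 - b)) = (y - a + 1)\<^sup>2 + (y + b) / (1 - b)"
      using assms second_moment_bound_ode by blast
    moreover have "0 \<le> (y + b) / (1 - b)" using assms y by simp
    ultimately show "- (a\<^sup>2 * exp (- y)) + (\<Sum>k\<le>(0::nat). (real k * (1 - b) - a)\<^sup>2 * gpois b k y)
        \<le> 2 * (y - a) + 1 / (1 - b) + ((y - a)\<^sup>2 + y / (1 - b))"
      by simp
  qed (use assms in \<open>auto intro!: derivative_eq_intros\<close>)
  then show ?case by simp
next
  case (Suc K)
  note IH = Suc.IH
  show ?case
  proof (rule ode_comparison[where h = "\<lambda>y. (y - a)\<^sup>2 + y / (1 - b)" and
        h' = "\<lambda>y. 2 * (y - a) + 1 / (1 - b)" and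
        g' = "\<lambda>y. (\<Sum>k<Suc K. (real (Suc k) * (1 - b) - a)\<^sup>2 * gpois b k (y + b))
          - (\<Sum>k\<le>Suc K. (real k * (1 - b) - a)\<^sup>2 * gpois b k y)", OF _ _ _ _ Suc.prems])
    fix y :: real assume y: "0 \<le> y"
    show "((\<lambda>y. \<Sum>k\<le>Suc K. (real k * (1 - b) - a)\<^sup>2 * gpois b k y) has_real_derivative
        (\<Sum>k<Suc K. (real (Suc k) * (1 - b) - a)\<^sup>2 * gpois b k (y + b))
          - (\<Sum>k\<le>Suc K. (real k * (1 - b) - a)\<^sup>2 * gpois b k y)) (at y)"
      by (rule has_real_derivative_gpois_weighted_sum)
    \<comment> \<open>Passing from k to k + 1 moves the centre from a to a - (1 - b), which is why
      the induction also generalises over a.\<close>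
    have "(\<Sum>k<Suc K. (real (Suc k) * (1 - b) - a)\<^sup>2 * gpois b k (y + b))
        = (\<Sum>k\<le>K. (real k * (1 - b) - (a - (1 - b)))\<^sup>2 * gpois b k (y + b))"
      by (simp add: lessThan_Suc_atMost algebra_simps)
    also have "\<dots> \<le> (y + b - (a - (1 - b)))\<^sup>2 + (y + b) / (1 - b)"
      using IH[of "y + b" "a - (1 - b)"] y assms by simp
    also have "\<dots> = 2 * (y - a) + 1 / (1 - b) + ((y - a)\<^sup>2 + y / (1 - b))"
      using second_moment_bound_ode[OF assms(2), of y a] by (simp add: algebra_simps)
    finally show "(\<Sum>k<Suc K. (real (Suc k) * (1 - b) - a)\<^sup>2 * gpois b k (y + b))
          - (\<Sum>k\<le>Suc K. (real k * (1 - b) - a)\<^sup>2 * gpois b k y)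
          + (\<Sum>k\<le>Suc K. (real k * (1 - b) - a)\<^sup>2 * gpois b k y)
        \<le> 2 * (y - a) + 1 / (1 - b) + ((y - a)\<^sup>2 + y / (1 - b))"
      by simp
  qed (use gpois_weighted_sum_at_0[of "\<lambda>k. (real k * (1 - b) - a)\<^sup>2" b "Suc K"] assms in
      \<open>auto intro!: derivative_eq_intros\<close>)
qed

text \<open>The same supersolution exp (l y), scaled by q^(-K), now bounds the missing mass: each
  further summand gains a factor 1 / q. For q > 1 the defect decays geometrically, so the full
  series has mass 1.\<close>

lemma gpois_mass_defect:
  assumes "0 \<le> b" "0 < q" "0 \<le> l" "q * exp (l * b) \<le> 1 + l" "0 \<le> y"
  shows "1 - (\<Sum>k\<le>K. gpois b k y) \<le> (1 / q) ^ K * exp (l * y)"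
  using assms(5)
proof (induction K arbitrary: y)
  case 0
  have "1 \<le> exp (l * y)" using assms 0 by simp
  moreover have "0 \<le> exp (- y)" by simp
  ultimately have "1 - exp (- y) \<le> exp (l * y)" by linarith
  then show ?case by simp
next
  case (Suc K)
  note IH = Suc.IH
  show ?case
  proof (rule ode_comparison[where g = "\<lambda>y. 1 - (\<Sum>k\<le>Suc K. gpois b k y)" and
        h = "\<lambda>y. (1 / q) ^ Suc K * exp (l * y)" and
        h' = "\<lambda>y. (1 / q) ^ Suc K * (l * exp (l * y))" and
        g' = "\<lambda>y. - ((\<Sum>k<Suc K. gpois b k (y + b)) - (\<Sum>k\<le>Suc K. gpois b k y))", OF _ _ _ _ Suc.prems])
    fix y :: real assume y: "0 \<le> y"
    have "((\<lambda>y. \<Sum>k\<le>Suc K. gpois b k y) has_real_derivative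
        (\<Sum>k<Suc K. gpois b k (y + b)) - (\<Sum>k\<le>Suc K. gpois b k y)) (at y)"
      using has_real_derivative_gpois_weighted_sum[of "\<lambda>_. 1" b "Suc K" y]
      by (simp only: mult_1)
    from DERIV_diff[OF DERIV_const[of 1] this]
    show "((\<lambda>y. 1 - (\<Sum>k\<le>Suc K. gpois b k y)) has_real_derivative
        - ((\<Sum>k<Suc K. gpois b k (y + b)) - (\<Sum>k\<le>Suc K. gpois b k y))) (at y)"
      by simp
    have "1 - (\<Sum>k<Suc K. gpois b k (y + b)) \<le> (1 / q) ^ K * exp (l * (y + b))"
      using IH[of "y + b"] y assms by (simp add: lessThan_Suc_atMost)
    also have "\<dots> = (1 / q) ^ Suc K * ((q * exp (l * b)) * exp (l * y))"
      using assms(2) by (simp add: distrib_left exp_add)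
    also have "\<dots> \<le> (1 / q) ^ Suc K * ((1 + l) * exp (l * y))"
      using assms(2,4) by (intro mult_left_mono mult_right_mono) auto
    finally show "- ((\<Sum>k<Suc K. gpois b k (y + b)) - (\<Sum>k\<le>Suc K. gpois b k y))
          + (1 - (\<Sum>k\<le>Suc K. gpois b k y))
        \<le> (1 / q) ^ Suc K * (l * exp (l * y)) + (1 / q) ^ Suc K * exp (l * y)"
      by (simp add: algebra_simps)
  qed (use gpois_weighted_sum_at_0[of "\<lambda>_. 1" b "Suc K"] assms in
      \<open>auto intro!: derivative_eq_intros\<close>)
qed

lemma exists_exponential_rate:
  fixes b :: real
  assumes "0 \<le> b" "b < 1"
  obtains q l :: real where "1 < q" "0 < l" "q * exp (l * b) \<le> 1 + l"
proof -
  \<comment> \<open>With q = (1 + l) exp (- l b) the required inequality is an equality. Then q > 1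
    follows from (1 + l) (1 - l b) > 1, that is b (1 + l) < 1; for this l it amounts to (1 - b) (2 -
    b) > 0.\<close>
  define l where "l = (1 - b) / 2"
  have l: "0 < l" "l \<le> 1 / 2" using assms by (auto simp: l_def)
  have "1 - l * b \<le> exp (- (l * b))" using exp_ge_add_one_self[of "- (l * b)"] by simp
  moreover have "1 < (1 + l) * (1 - l * b)"
  proof -
    have "l * b * (1 + l) < l"
    proof -
      have "b * (1 + l) < 1"
        using assms mult_pos_pos[of "1 - b" "2 - b"] by (simp add: l_def field_simps)
      then show ?thesis using l by (simp add: mult.assoc)
    qed
    then show ?thesis by (simp add: algebra_simps)
  qed
  ultimately have "1 < (1 + l) * exp (- (l * b))"
    using l by (smt (verit) mult_left_mono)
  then show ?thesis
    using l by (intro that[of "(1 + l) * exp (- (l * b))" l]) (auto simp: exp_minus)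
qed

lemma nonneg_partial_sums_bounded:
  fixes c :: "nat \<Rightarrow> real"
  assumes "\<And>k. 0 \<le> c k" "\<And>K. (\<Sum>k\<le>K. c k) \<le> B"
  shows "summable c" "suminf c \<le> B"
proof -
  have *: "(\<Sum>k<n. c k) \<le> B" for n
    using assms(1) by (intro order_trans[OF sum_mono2 assms(2)[of n]]) auto
  show "summable c" by (rule summableI_nonneg_bounded[OF assms(1) *])
  then show "suminf c \<le> B" by (rule suminf_le_const[OF _ *])
qed

lemma gpois_sums_1:
  assumes "0 \<le> b" "b < 1" "0 \<le> y"
  shows "(\<lambda>k. gpois b k y) sums 1"
proof -
  obtain q l :: real where ql: "1 < q" "0 < l" "q * exp (l * b) \<le> 1 + l"
    using exists_exponential_rate assms by blast
  have lim0: "(\<lambda>K. (1 / q) ^ K * exp (l * y)) \<longlonglongrightarrow> 0"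
    using ql by (intro tendsto_mult_left_zero LIMSEQ_power_zero) auto
  have "(\<lambda>K. 1 - (\<Sum>k\<le>K. gpois b k y)) \<longlonglongrightarrow> 0"
  proof (rule tendsto_sandwich[OF _ _ tendsto_const lim0])
    show "\<forall>\<^sub>F K in sequentially. 0 \<le> 1 - (\<Sum>k\<le>K. gpois b k y)"
      using gpois_sum_le_1 assms by (intro always_eventually) auto
    show "\<forall>\<^sub>F K in sequentially. 1 - (\<Sum>k\<le>K. gpois b k y) \<le> (1 / q) ^ K * exp (l * y)"
      using gpois_mass_defect[of b q l y] ql assms by (intro always_eventually) auto
  qed
  from tendsto_diff[OF tendsto_const[of 1] this]
  show ?thesis by (simp add: sums_def_le)
qed

section \<open>Integration of polynomials against exp (- s) on the half line\<close>

lemma set_integral_FTC_atLeast: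
  fixes f F :: "real \<Rightarrow> real"
  assumes f: "set_integrable lborel {a..} f" and cont: "\<And>x. a \<le> x \<Longrightarrow> isCont f x"
    and F: "\<And>x. a \<le> x \<Longrightarrow> (F has_real_derivative f x) (at x)" and lim: "(F \<longlongrightarrow> T) at_top"
  shows "(LBINT x:{a..}. f x) = T - F a"
proof -
  have eq: "(\<integral>x. indicator {.. y} x *\<^sub>R (indicator {a..} x *\<^sub>R f x) \<partial>lborel) = F y - F a" if "a \<le> y" for y
  proof -
    have "(\<integral>x. f x * indicator {a..y} x \<partial>lborel) = F y - F a"
      using that cont F by (intro integral_FTC_Icc_real) auto
    moreover have "(\<lambda>x. indicator {.. y} x *\<^sub>R (indicator {a..} x *\<^sub>R f x)) = (\<lambda>x. f x * indicator {a..y} x)"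
      by (auto simp: indicator_def fun_eq_iff)
    ultimately show ?thesis by simp
  qed
  \<comment> \<open>Integrability makes the truncated integrals converge without a sign condition on
    f. This matters because the derivative integrated for the second moment need not have constant
    sign.\<close>
  have "((\<lambda>y. F y - F a) \<longlongrightarrow> (LBINT x:{a..}. f x)) at_top"
    unfolding set_lebesgue_integral_def
  proof (rule Lim_transform_eventually)
    show "((\<lambda>y. \<integral>x. indicator {.. y} x *\<^sub>R (indicator {a..} x *\<^sub>R f x) \<partial>lborel)
        \<longlongrightarrow> (\<integral>x. indicator {a..} x *\<^sub>R f x \<partial>lborel)) at_top"
      using f unfolding set_integrable_def by (intro tendsto_integral_at_top) auto
    show "\<forall>\<^sub>F y in at_top. (\<integral>x. indicator {.. y} x *\<^sub>R (indicator {a..} x *\<^sub>R f x) \<partial>lborel) = F y - F a"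
      using eq by (rule eventually_mono[OF eventually_ge_at_top])
  qed
  moreover have "((\<lambda>y. F y - F a) \<longlongrightarrow> T - F a) at_top"
    by (intro tendsto_intros lim)
  ultimately show ?thesis by (intro tendsto_unique) auto
qed

lemma polynomial_exp_minus_integrable:
  assumes "real_polynomial_function p"
  shows "set_integrable lborel {0..} (\<lambda>s. p s * exp (- s))"
proof -
  obtain a n where p: "p = (\<lambda>x. \<Sum>i\<le>n. a i * x ^ i)"
    using assms real_polynomial_function_iff_sum by auto
  have mono: "integrable lborel (\<lambda>x. x^k * exp (-x) * indicator {0 ..} x::real)" for k
    using nn_intergal_power_times_exp_Ici[of k]
    by (intro has_bochner_integral_nn_integral[THEN integrable.intros, of _ _ "fact k"])
      (auto simp: nn_integral_set_ennreal split: split_indicator)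
  have "integrable lborel (\<lambda>x. \<Sum>i\<le>n. a i * (x^i * exp (-x) * indicator {0 ..} x))"
    by (intro Bochner_Integration.integrable_sum integrable_mult_right mono)
  then show ?thesis unfolding set_integrable_def p
    by (simp add: sum_distrib_right sum_distrib_left mult_ac)
qed

lemma polynomial_exp_minus_tendsto_0:
  assumes "real_polynomial_function p"
  shows "((\<lambda>s. p s * exp (- s)) \<longlongrightarrow> 0) at_top"
proof -
  obtain a n where p: "p = (\<lambda>x. \<Sum>i\<le>n. a i * x ^ i)"
    using assms real_polynomial_function_iff_sum by auto
  have "((\<lambda>s. \<Sum>i\<le>n. a i * (s ^ i / exp s)) \<longlongrightarrow> (\<Sum>i\<le>n. a i * 0)) at_top"
    by (intro tendsto_intros tendsto_power_div_exp_0)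
  then show ?thesis by (simp add: p exp_minus field_simps sum_divide_distrib)
qed

lemma has_bochner_integral_exp_minus_atLeast:
  "has_bochner_integral lborel (\<lambda>s. indicator {a..} s *\<^sub>R exp (- s)) (exp (- a :: real))"
proof (rule has_bochner_integral_nn_integral)
  have "((\<lambda>s. - exp (- s)) \<longlongrightarrow> - 0) (at_top :: real filter)"
    by (intro tendsto_minus filterlim_compose[OF exp_at_bot] filterlim_uminus_at_bot_at_top)
  then have "(\<integral>\<^sup>+s. ennreal (exp (- s)) * indicator {a..} s \<partial>lborel) = ennreal (0 - - exp (- a))"
    by (intro nn_integral_FTC_atLeast) (auto intro!: derivative_eq_intros)
  then show "(\<integral>\<^sup>+s. ennreal (indicator {a..} s *\<^sub>R exp (- s)) \<partial>lborel) = ennreal (exp (- a))"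
    by (simp add: nn_integral_set_ennreal mult.commute)
qed auto

lemma gpois_split_exp:
  "0 < k \<Longrightarrow> gpois b k s = s * (s + real k * b) ^ (k - 1) / fact k * exp (- (real k * b)) * exp (- s)"
  by (simp add: gpois_def mult.assoc flip: exp_add)

lemma gpois_eq_polynomial_exp:
  obtains p where "real_polynomial_function p" "\<And>s. gpois b k s = p s * exp (- s)"
proof (cases k)
  case 0
  show ?thesis by (rule that[of "\<lambda>_. 1"]) (auto simp: 0 intro: real_polynomial_function.intros)
next
  case (Suc j)
  show ?thesis
  proof (rule that)
    show "real_polynomial_function
      (\<lambda>s. (exp (- (real k * b)) / fact k) * (s * (s + real k * b) ^ (k - 1)))"
      by (intro real_polynomial_function.intros real_polynomial_function_power) (auto intro: bounded_linear_ident)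
    show "gpois b k s = (exp (- (real k * b)) / fact k) * (s * (s + real k * b) ^ (k - 1)) * exp (- s)" for s
      using gpois_split_exp[of k b s] Suc by simp
  qed
qed

lemma polynomial_gpois_integrable:
  assumes "real_polynomial_function r"
  shows "set_integrable lborel {0..} (\<lambda>s. gpois b k s * r s)"
proof -
  obtain p where p: "real_polynomial_function p" "\<And>s. gpois b k s = p s * exp (- s)"
    using gpois_eq_polynomial_exp by blast
  have "set_integrable lborel {0..} (\<lambda>s. (p s * r s) * exp (- s))"
    by (rule polynomial_exp_minus_integrable[OF real_polynomial_function.intros(4)[OF p(1) assms]])
  then show ?thesis by (simp add: p mult_ac)
qed

lemma gpois_integrable: "set_integrable lborel {0..} (gpois b k)"
  using polynomial_gpois_integrable[of "\<lambda>_. 1" b k] by (auto intro: real_polynomial_function.intros)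

section \<open>Mass, tails and second moment of a weight as a function of its argument\<close>

definition gpois_mass :: "real \<Rightarrow> nat \<Rightarrow> real" where
  "gpois_mass b k = (LBINT s:{0..}. gpois b k s)"

text \<open>The polynomial factor of \<open>gpois b k\<close> is increasing, so the mass to the right of \<open>r\<close> is
  at least \<open>gpois b k r\<close>.\<close>

lemma gpois_le_mass:
  assumes "0 \<le> b" "0 \<le> r"
  shows "gpois b k r \<le> gpois_mass b k"
proof -
  \<comment> \<open>\<open>gpois b k r * exp r\<close> is the value at r of the polynomial factor.
    Integrating exp (- s) over s \<ge> r restores exactly the factor exp (- r).\<close>
  have le: "gpois b k r * exp r * exp (- s) \<le> gpois b k s" if "r \<le> s" for s
  proof (cases k)
    case 0
    then show ?thesis by (simp add: exp_minus)
  next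
    case (Suc j)
    let ?c = "real k * b"
    have "gpois b k r * exp r = r * (r + ?c) ^ (k - 1) / fact k * exp (- ?c)"
      using gpois_split_exp[of k b r] Suc by (simp add: mult.assoc flip: exp_add)
    also have "\<dots> \<le> s * (s + ?c) ^ (k - 1) / fact k * exp (- ?c)"
      using that assms by (intro mult_right_mono divide_right_mono mult_mono power_mono) auto
    finally have "gpois b k r * exp r * exp (- s) \<le> s * (s + ?c) ^ (k - 1) / fact k * exp (- ?c) * exp (- s)"
      by (intro mult_right_mono) auto
    also have "\<dots> = gpois b k s"
      using gpois_split_exp[of k b s] Suc by simp
    finally show ?thesis .
  qed
  have hb: "has_bochner_integral lborel (\<lambda>s. (gpois b k r * exp r) * (indicator {r..} s *\<^sub>R exp (- s)))
      ((gpois b k r * exp r) * exp (- r))"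
    by (intro has_bochner_integral_mult_right has_bochner_integral_exp_minus_atLeast)
  have "(gpois b k r * exp r) * exp (- r)
      = (\<integral>s. (gpois b k r * exp r) * (indicator {r..} s *\<^sub>R exp (- s)) \<partial>lborel)"
    by (rule has_bochner_integral_integral_eq[OF hb, symmetric])
  also have "\<dots> \<le> (\<integral>s. indicator {0..} s *\<^sub>R gpois b k s \<partial>lborel)"
  proof (rule integral_mono)
    show "integrable lborel (\<lambda>s. (gpois b k r * exp r) * (indicator {r..} s *\<^sub>R exp (- s)))"
      by (rule integrable.intros[OF hb])
    show "integrable lborel (\<lambda>s. indicator {0..} s *\<^sub>R gpois b k s)"
      using gpois_integrable unfolding set_integrable_def .
    show "(gpois b k r * exp r) * (indicator {r..} s *\<^sub>R exp (- s)) \<le> indicator {0..} s *\<^sub>R gpois b k s" for s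
      using le[of s] gpois_nonneg[of b s k] assms by (auto simp: indicator_def)
  qed
  finally show ?thesis
    by (simp add: gpois_mass_def set_lebesgue_integral_def mult.assoc flip: exp_add)
qed

lemma gpois_mass_pos:
  assumes "0 \<le> b"
  shows "0 < gpois_mass b k"
proof -
  have "0 < 1 + real k * b" using assms by (simp add: add_pos_nonneg)
  then have "0 < gpois b k 1" by (simp add: gpois_def)
  then show ?thesis using gpois_le_mass[OF assms, of 1 k] by simp
qed

text \<open>Compare the values at s and s / q. Each of the k linear factors grows by at most q,
  because s + c \<le> q (s / q + c) for c \<ge> 0, while the exponentials differ by exp (- (s - s /
  q)). Stating the bound relative to the mass makes it usable after normalisation.\<close>

lemma gpois_exponential_tail:
  assumes "0 \<le> b" "1 \<le> q" "0 \<le> s"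
  shows "gpois b k s \<le> q ^ k * exp (- ((1 - 1 / q) * s)) * gpois_mass b k"
proof -
  have "gpois b k s \<le> q ^ k * exp (- ((1 - 1 / q) * s)) * gpois b k (s / q)"
  proof (cases k)
    case 0
    then show ?thesis using assms by (simp add: algebra_simps flip: exp_add)
  next
    case (Suc j)
    let ?c = "real k * b"
    have "s + ?c \<le> q * (s / q + ?c)"
      using assms mult_right_mono[of 1 q ?c] by (simp add: distrib_left)
    then have pw: "(s + ?c) ^ j \<le> q ^ j * (s / q + ?c) ^ j"
      using assms by (subst power_mult_distrib[symmetric], intro power_mono) auto
    have ex: "exp (- (s + ?c)) = exp (- ((1 - 1 / q) * s)) * exp (- (s / q + ?c))"
      unfolding exp_add[symmetric] by (simp add: left_diff_distrib)
    have "gpois b k s = s * (s + ?c) ^ j / fact k * exp (- (s + ?c))"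
      by (simp add: gpois_def Suc)
    also have "\<dots> \<le> s * (q ^ j * (s / q + ?c) ^ j) / fact k * exp (- (s + ?c))"
      using assms pw by (intro mult_right_mono divide_right_mono mult_left_mono) auto
    also have "\<dots> = q ^ k * exp (- ((1 - 1 / q) * s)) * (s / q * (s / q + ?c) ^ j / fact k * exp (- (s / q + ?c)))"
      unfolding ex using assms by (simp add: Suc)
    also have "\<dots> = q ^ k * exp (- ((1 - 1 / q) * s)) * gpois b k (s / q)"
      by (simp add: gpois_def Suc)
    finally show ?thesis .
  qed
  also have "\<dots> \<le> q ^ k * exp (- ((1 - 1 / q) * s)) * gpois_mass b k"
    using assms by (intro mult_left_mono gpois_le_mass) auto
  finally show ?thesis .
qed

text \<open>Integrate the derivative of C Q(s) (s + c)^k exp (- s) for a quadratic Q. This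
  derivative dominates \<open>gpois b k s * ((s - m)\<^sup>2 - V)\<close> pointwise, and its
  integral is minus the boundary value at 0, hence at most 0.\<close>

lemma gpois_second_moment_integral:
  fixes b :: real and k :: nat
  defines "m \<equiv> real k * (1 - b)"
  assumes "0 \<le> b" "b < 1"
  shows "(LBINT s:{0..}. gpois b k s * (s - m)\<^sup>2) \<le> (2 * real k + 2 / (1 - b)) * gpois_mass b k"
proof -
  define c g C where "c = real k * b" and "g = b / (1 - b)" and "C = exp (- c) / fact k"
  \<comment> \<open>The coefficients of s^2 and s are forced by matching s ((s - m)^2 - V) up to a
    nonnegative remainder. The constant 2 g does two jobs: it keeps Q(0) nonnegative, and through g
    m = c it cancels a term - 2 c in the remainder.\<close>
  define Q where "Q s = - s\<^sup>2 + (m - 2) * s + 2 * g" for s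
  define h where "h s = C * ((s\<^sup>2 - m * s + (m - 2 - 2 * g)) * (s + c) ^ k + Q s * (real k * (s + c) ^ (k - 1)))" for s
  define V where "V = 2 * real k + 2 / (1 - b)"
  have V: "V = 2 * real k + 2 + 2 * g"
    using assms by (simp add: V_def g_def field_simps)
  have gm: "g * m = c"
    using assms(3) by (simp add: g_def c_def m_def)
  have mc: "m = real k - c"
    by (simp add: c_def m_def algebra_simps)
  have c0: "0 \<le> c" and g0: "0 \<le> g" and m0: "0 \<le> m" and C0: "0 \<le> C"
    using assms by (auto simp: c_def g_def C_def)
  have Qpoly: "real_polynomial_function Q"
    unfolding Q_def minus_real_def
    by (intro real_polynomial_function.intros real_polynomial_function_power
        real_polynomial_function_minus) (auto intro: bounded_linear_ident)
  have hpoly: "real_polynomial_function h"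
    unfolding h_def
    by (intro real_polynomial_function.intros(2-) real_polynomial_function_power Qpoly
        real_polynomial_function_diff real_polynomial_function.intros(1)[OF bounded_linear_ident])
  have Hpoly: "real_polynomial_function (\<lambda>s. C * (Q s * (s + c) ^ k))"
    by (intro real_polynomial_function.intros(2-) real_polynomial_function_power Qpoly
        real_polynomial_function.intros(1)[OF bounded_linear_ident])
  have hint: "set_integrable lborel {0..} (\<lambda>s. h s * exp (- s))"
    by (rule polynomial_exp_minus_integrable[OF hpoly])
  have deriv: "((\<lambda>s. C * (Q s * (s + c) ^ k) * exp (- s)) has_real_derivative h s * exp (- s)) (at s)" for s
  proof -
    have Q': "(Q has_real_derivative (- 2 * s + (m - 2))) (at s)"
      unfolding Q_def by (auto intro!: derivative_eq_intros)
    have P': "((\<lambda>s. (s + c) ^ k) has_real_derivative real k * (s + c) ^ (k - 1)) (at s)"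
      by (auto intro!: derivative_eq_intros)
    have E': "((\<lambda>s. exp (- s)) has_real_derivative - exp (- s)) (at s)"
      by (auto intro!: derivative_eq_intros)
    have "((\<lambda>s. C * (Q s * (s + c) ^ k) * exp (- s)) has_real_derivative
       C * ((- 2 * s + (m - 2)) * (s + c) ^ k + real k * (s + c) ^ (k - 1) * Q s) * exp (- s)
       + - exp (- s) * (C * (Q s * (s + c) ^ k))) (at s)"
      by (intro DERIV_mult DERIV_cmult Q' P' E')
    moreover have "C * ((- 2 * s + (m - 2)) * (s + c) ^ k + real k * (s + c) ^ (k - 1) * Q s) * exp (- s)
       + - exp (- s) * (C * (Q s * (s + c) ^ k)) = h s * exp (- s)"
      unfolding h_def Q_def by (simp add: algebra_simps power2_eq_square)
    ultimately show ?thesis by simp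
  qed
  have hcont: "isCont (\<lambda>s. h s * exp (- s)) s" for s
    by (intro continuous_intros continuous_real_polymonial_function hpoly)
  have "(LBINT s:{0..}. h s * exp (- s)) = 0 - C * (Q 0 * (0 + c) ^ k) * exp (- 0)"
    by (intro set_integral_FTC_atLeast hint hcont deriv polynomial_exp_minus_tendsto_0 Hpoly)
  moreover have "0 \<le> C * (Q 0 * (0 + c) ^ k) * exp (- 0)"
    using C0 c0 g0 by (simp add: Q_def)
  ultimately have neg: "(LBINT s:{0..}. h s * exp (- s)) \<le> 0" by simp
  have le: "gpois b k s * ((s - m)\<^sup>2 - V) \<le> h s * exp (- s)" if "0 \<le> s" for s
  proof (cases k)
    case 0
    then have "c = 0" "m = 0" by (auto simp: c_def m_def)
    then show ?thesis by (simp add: h_def Q_def C_def V 0 algebra_simps)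
  next
    case (Suc j)
    \<comment> \<open>After removing C (s + c)^(k - 1) exp (- s), the left side is the derivative
      and the first summand on the right comes from the weight. The remainder s m + c m is
      nonnegative and can be discarded.\<close>
    have key: "(s\<^sup>2 - m * s + (m - 2 - 2 * g)) * (s + c) + Q s * real k
       = s * ((s - m)\<^sup>2 - V) + s * m + c * m"
    proof -
      have k: "real k = m + c" using mc by simp
      have "(s\<^sup>2 - m * s + (m - 2 - 2 * g)) * (s + c) + Q s * real k
          - (s * ((s - m)\<^sup>2 - V) + s * m + c * m) = 2 * (g * m) - 2 * c"
        unfolding Q_def V k by (simp add: algebra_simps power2_eq_square)
      then show ?thesis using gm by simp
    qed
    have pw: "(s + c) ^ k = (s + c) ^ j * (s + c)" by (simp add: Suc)
    have "gpois b k s * ((s - m)\<^sup>2 - V) = C * (s + c) ^ j * (s * ((s - m)\<^sup>2 - V)) * exp (- s)"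
      using gpois_split_exp[of k b s] by (simp add: Suc C_def c_def)
    also have "\<dots> \<le> C * (s + c) ^ j * (s * ((s - m)\<^sup>2 - V) + s * m + c * m) * exp (- s)"
      using C0 c0 m0 that by (intro mult_right_mono mult_left_mono) auto
    also have "\<dots> = C * (s + c) ^ j * ((s\<^sup>2 - m * s + (m - 2 - 2 * g)) * (s + c) + Q s * real k) * exp (- s)"
      by (simp only: key)
    also have "\<dots> = h s * exp (- s)"
      unfolding h_def pw by (simp add: Suc algebra_simps)
    finally show ?thesis .
  qed
  have i1: "set_integrable lborel {0..} (\<lambda>s. gpois b k s * (s - m)\<^sup>2)"
    by (intro polynomial_gpois_integrable real_polynomial_function_power real_polynomial_function_diff
        real_polynomial_function.intros(1)[OF bounded_linear_ident] real_polynomial_function.intros(2))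
  have i2: "set_integrable lborel {0..} (\<lambda>s. V * gpois b k s)"
    by (intro set_integrable_mult_right gpois_integrable)
  have "(LBINT s:{0..}. gpois b k s * (s - m)\<^sup>2) - V * gpois_mass b k
      = (LBINT s:{0..}. gpois b k s * (s - m)\<^sup>2 - V * gpois b k s)"
    unfolding gpois_mass_def using i1 i2 by (subst set_integral_diff) auto
  also have "\<dots> \<le> (LBINT s:{0..}. h s * exp (- s))"
    using le by (intro set_integral_mono set_integral_diff i1 i2 hint) (auto simp: algebra_simps)
  finally show ?thesis using neg V_def by simp
qed

text \<open>Recentring at y leaves the discrete deviation k (1 - b) - y, whose square is controlled
  when averaged over k by \<open>gpois_second_moment_partial\<close>.\<close>

lemma gpois_second_moment_integral_shifted:
  assumes "0 \<le> b" "b < 1"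
  shows "(LBINT s:{0..}. gpois b k s * (s - y)\<^sup>2)
    \<le> (4 * real k + 4 / (1 - b) + 2 * (real k * (1 - b) - y)\<^sup>2) * gpois_mass b k"
proof -
  let ?m = "real k * (1 - b)"
  have i: "set_integrable lborel {0..} (\<lambda>s. gpois b k s * (s - z)\<^sup>2)" for z
    by (intro polynomial_gpois_integrable real_polynomial_function_power real_polynomial_function_diff
        real_polynomial_function.intros(1)[OF bounded_linear_ident] real_polynomial_function.intros(2))
  have i2: "set_integrable lborel {0..} (\<lambda>s. 2 * (gpois b k s * (s - ?m)\<^sup>2))"
    "set_integrable lborel {0..} (\<lambda>s. 2 * (?m - y)\<^sup>2 * gpois b k s)"
    by (intro set_integrable_mult_right gpois_integrable i)+
  have "(LBINT s:{0..}. gpois b k s * (s - y)\<^sup>2)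
      \<le> (LBINT s:{0..}. 2 * (gpois b k s * (s - ?m)\<^sup>2) + 2 * (?m - y)\<^sup>2 * gpois b k s)"
  proof (intro set_integral_mono set_integral_add i i2)
    fix s :: real assume "s \<in> {0..}"
    then have g: "0 \<le> gpois b k s" using assms by (simp add: gpois_nonneg)
    have "(s - y)\<^sup>2 \<le> 2 * (s - ?m)\<^sup>2 + 2 * (?m - y)\<^sup>2"
      using zero_le_power2[of "(s - ?m) - (?m - y)"] by (simp add: power2_eq_square algebra_simps)
    from mult_left_mono[OF this g]
    show "gpois b k s * (s - y)\<^sup>2 \<le> 2 * (gpois b k s * (s - ?m)\<^sup>2) + 2 * (?m - y)\<^sup>2 * gpois b k s"
      by (simp add: algebra_simps)
  qed
  also have "\<dots> = 2 * (LBINT s:{0..}. gpois b k s * (s - ?m)\<^sup>2) + 2 * (?m - y)\<^sup>2 * gpois_mass b k"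
    using i2 by (simp add: set_integral_add gpois_mass_def)
  also have "\<dots> \<le> 2 * ((2 * real k + 2 / (1 - b)) * gpois_mass b k) + 2 * (?m - y)\<^sup>2 * gpois_mass b k"
    using gpois_second_moment_integral[OF assms, of k] by simp
  finally show ?thesis by (simp add: algebra_simps)
qed

section \<open>From weights to operators: rescaling, local modulus and error bounds\<close>

lemma set_integral_scale_half_line:
  fixes g :: "real \<Rightarrow> real"
  assumes "0 < n"
  shows "(LBINT t:{0..}. g (n * t)) = (LBINT s:{0..}. g s) / n"
    and "set_integrable lborel {0..} (\<lambda>t. g (n * t)) \<longleftrightarrow> set_integrable lborel {0..} g"
proof -
  have eq: "(\<lambda>t. indicator {0..} t *\<^sub>R g (n * t)) = (\<lambda>t. indicator {0..} (0 + n * t) *\<^sub>R g (0 + n * t))"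
    using assms by (auto simp: indicator_def zero_le_mult_iff fun_eq_iff)
  show "(LBINT t:{0..}. g (n * t)) = (LBINT s:{0..}. g s) / n"
    unfolding set_lebesgue_integral_def eq
    using assms lborel_integral_real_affine[of n "\<lambda>s. indicator {0..} s *\<^sub>R g s" 0] by simp
  show "set_integrable lborel {0..} (\<lambda>t. g (n * t)) \<longleftrightarrow> set_integrable lborel {0..} g"
    unfolding set_integrable_def eq
    using assms lborel_integrable_real_affine_iff[of n "\<lambda>s. indicator {0..} s *\<^sub>R g s" 0] by simp
qed

text \<open>Near x uniform continuity on [0, R] gives e; farther away within [0, R] boundedness is
  absorbed by the quadratic term. Beyond R nothing is known about the size of f, so |f t| stays in
  the bound and only f x is absorbed, using t - x \<ge> 1.\<close>

lemma continuous_half_line_quadratic_modulus: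
  fixes f :: "real \<Rightarrow> real"
  assumes f: "continuous_on {0..} f" and e: "0 < e" and R: "X + 1 \<le> R" and X: "0 \<le> X"
  shows "\<exists>D\<ge>0. \<forall>x\<in>{0..X}. \<forall>t\<ge>0.
    \<bar>f t - f x\<bar> \<le> e + D * (t - x)\<^sup>2 + indicator {R<..} t * \<bar>f t\<bar>"
proof -
  have c: "continuous_on {0..R} f" using f by (rule continuous_on_subset) auto
  obtain d where d: "0 < d" "\<And>x t. \<lbrakk>x \<in> {0..R}; t \<in> {0..R}; dist t x < d\<rbrakk> \<Longrightarrow> dist (f t) (f x) < e"
    using compact_uniformly_continuous[OF c] e unfolding uniformly_continuous_on_def by (metis compact_Icc)
  obtain M where M: "\<And>t. t \<in> {0..R} \<Longrightarrow> \<bar>f t\<bar> \<le> M"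
    using compact_imp_bounded[OF compact_continuous_image[OF c compact_Icc]]
    unfolding bounded_iff by (metis imageI real_norm_def)
  have M0: "0 \<le> M" using M[of 0] R X by auto
  \<comment> \<open>The first summand serves t \<le> R with |t - x| \<ge> d, the second serves t >
    R.\<close>
  define D where "D = 2 * M / d\<^sup>2 + M"
  have D: "0 \<le> D" using M0 by (simp add: D_def)
  have "\<bar>f t - f x\<bar> \<le> e + D * (t - x)\<^sup>2 + indicator {R<..} t * \<bar>f t\<bar>"
    if x: "0 \<le> x" "x \<le> X" and t: "0 \<le> t" for x t
  proof (cases "t \<le> R")
    case True
    show ?thesis
    proof (cases "\<bar>t - x\<bar> < d")
      case close: True
      then have "\<bar>f t - f x\<bar> < e" using d(2)[of x t] x t True R by (simp add: dist_real_def)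
      then show ?thesis using D by (simp add: True add_increasing2)
    next
      case False
      then have "d\<^sup>2 \<le> \<bar>t - x\<bar>\<^sup>2" using d(1) by (intro power_mono) auto
      then have "2 * M \<le> 2 * M / d\<^sup>2 * (t - x)\<^sup>2"
        using d(1) M0 mult_left_mono[of "d\<^sup>2" "(t - x)\<^sup>2" "2 * M / d\<^sup>2"] by simp
      also have "\<dots> \<le> D * (t - x)\<^sup>2" using M0 by (intro mult_right_mono) (auto simp: D_def)
      finally have "2 * M \<le> D * (t - x)\<^sup>2" .
      then show ?thesis using M[of t] M[of x] x t True R e by (simp add: abs_le_iff)
    qed
  next
    case False
    then have "1 \<le> t - x" using x R by simp
    then have "1 \<le> (t - x)\<^sup>2" by simp
    then have "M * 1 \<le> M * (t - x)\<^sup>2" using M0 by (intro mult_left_mono)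
    also have "\<dots> \<le> D * (t - x)\<^sup>2" using M0 by (intro mult_right_mono) (auto simp: D_def)
    finally have "M \<le> D * (t - x)\<^sup>2" by simp
    moreover have "\<bar>f t - f x\<bar> \<le> \<bar>f t\<bar> + \<bar>f x\<bar>" by (rule abs_triangle_ineq4)
    moreover have "\<bar>f x\<bar> \<le> M" using M x R by simp
    ultimately show ?thesis using e False by simp
  qed
  with D show ?thesis by auto
qed

text \<open>The pointwise bound on f t - f x is multiplied by the kernel and integrated. The
  quadratic part becomes a second moment after scaling by n, and the part beyond R is controlled by
  the tilted tail bound together with integrability of exp (- N t) f(t).\<close>

lemma phillips_coefficient_error:
  fixes f :: "real \<Rightarrow> real"
  assumes b: "0 \<le> b" "b < 1" and n: "0 < n"
    and fi: "set_integrable lborel {0..} (\<lambda>t. jain_basis b n k t * f t)"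
    and q: "1 < q" and N: "N \<le> (1 - 1 / q) * real n"
    and fN: "set_integrable lborel {0..} (\<lambda>t. exp (- (N * t)) * f t)"
    and D: "0 \<le> D" and e: "0 \<le> e"
    and fx: "\<And>t. 0 \<le> t \<Longrightarrow> \<bar>f t - f x\<bar> \<le> e + D * (t - x)\<^sup>2 + indicator {R<..} t * \<bar>f t\<bar>"
  shows "\<bar>half_line_inner (jain_basis b n k) f / half_line_inner (jain_basis b n k) (\<lambda>_. 1) - f x\<bar>
    \<le> e + D / (real n)\<^sup>2 * (4 * real k + 4 / (1 - b) + 2 * (real k * (1 - b) - real n * x)\<^sup>2)
      + real n * exp (- (((1 - 1 / q) * real n - N) * R)) * (LBINT t:{0..}. \<bar>exp (- (N * t)) * f t\<bar>) * q ^ k"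
proof -
  define L where "L = jain_basis b n k"
  define Z where "Z = gpois_mass b k"
  define E where "E = exp (- (((1 - 1 / q) * real n - N) * R))"
  define F where "F = (LBINT t:{0..}. \<bar>exp (- (N * t)) * f t\<bar>)"
  define S where "S = 4 * real k + 4 / (1 - b) + 2 * (real k * (1 - b) - real n * x)\<^sup>2"
  have Z: "0 < Z" using b gpois_mass_pos by (simp add: Z_def)
  have n': "0 < real n" using n by simp
  have L: "L = (\<lambda>t. gpois b k (real n * t))" by (simp add: L_def fun_eq_iff jain_basis_eq_gpois)
  have Lnn: "0 \<le> L t" if "0 \<le> t" for t using that b by (simp add: L gpois_nonneg)
  have Li: "set_integrable lborel {0..} L"
    unfolding L by (simp add: set_integral_scale_half_line(2)[OF n'] gpois_integrable)
  have LZ: "(LBINT t:{0..}. L t) = Z / n"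
    unfolding L set_integral_scale_half_line(1)[OF n'] Z_def gpois_mass_def ..
  have sq: "(\<lambda>t. L t * (t - x)\<^sup>2) = (\<lambda>t::real. (gpois b k (n * t) * (n * t - n * x)\<^sup>2) / (real n)\<^sup>2)"
    using n' by (simp add: fun_eq_iff L power2_eq_square field_simps)
  have i2: "set_integrable lborel {0..} (\<lambda>t. L t * (t - x)\<^sup>2)"
  proof -
    have "set_integrable lborel {0..} (\<lambda>s. gpois b k s * (s - n * x)\<^sup>2)"
      by (intro polynomial_gpois_integrable real_polynomial_function_power real_polynomial_function_diff
          real_polynomial_function.intros(1)[OF bounded_linear_ident] real_polynomial_function.intros(2))
    then have "set_integrable lborel {0..} (\<lambda>t::real. gpois b k (n * t) * (n * t - n * x)\<^sup>2)"
      using set_integral_scale_half_line(2)[OF n', of "\<lambda>s. gpois b k s * (s - n * x)\<^sup>2"] by blast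
    then show ?thesis unfolding sq by (rule set_integrable_divide)
  qed
  have L2: "(LBINT t:{0..}. L t * (t - x)\<^sup>2) \<le> S * Z / n / (real n)\<^sup>2"
  proof -
    have "(LBINT t:{0..}. L t * (t - x)\<^sup>2) = (LBINT s:{0..}. gpois b k s * (s - n * x)\<^sup>2) / n / (real n)\<^sup>2"
      unfolding sq set_integral_divide_zero
      using set_integral_scale_half_line(1)[OF n', of "\<lambda>s. gpois b k s * (s - n * x)\<^sup>2"] by simp
    also have "\<dots> \<le> S * Z / n / (real n)\<^sup>2"
      using gpois_second_moment_integral_shifted[OF b, of k "n * x"]
      by (intro divide_right_mono) (auto simp: S_def Z_def)
    finally show ?thesis .
  qed
  \<comment> \<open>The tilted exponent (1 - 1 / q) n t is split into N t, which stays with f, and a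
    remainder with nonnegative rate, which for t > R is at least its value at R.\<close>
  have tail: "L t * (indicator {R<..} t * \<bar>f t\<bar>) \<le> q ^ k * Z * E * \<bar>exp (- (N * t)) * f t\<bar>" if t: "0 \<le> t" for t
  proof (cases "R < t")
    case True
    have "L t \<le> q ^ k * exp (- ((1 - 1 / q) * (n * t))) * Z"
      unfolding L Z_def using b q t by (intro gpois_exponential_tail) auto
    also have "\<dots> \<le> q ^ k * (E * exp (- (N * t))) * Z"
    proof -
      have "((1 - 1 / q) * real n - N) * R \<le> ((1 - 1 / q) * real n - N) * t"
        using True N by (intro mult_left_mono) auto
      then have "exp (- ((1 - 1 / q) * (n * t))) \<le> E * exp (- (N * t))"
        unfolding E_def exp_add[symmetric] by (simp add: algebra_simps)
      then show ?thesis using q Z by (intro mult_right_mono mult_left_mono) auto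
    qed
    finally have "L t * \<bar>f t\<bar> \<le> q ^ k * (E * exp (- (N * t))) * Z * \<bar>f t\<bar>"
      by (rule mult_right_mono) auto
    then show ?thesis using True by (simp add: abs_mult mult_ac)
  next
    case False
    then show ?thesis using q Z by (simp add: E_def)
  qed
  have i3: "set_integrable lborel {0..} (\<lambda>t. e * L t)"
    "set_integrable lborel {0..} (\<lambda>t. D * (L t * (t - x)\<^sup>2))"
    "set_integrable lborel {0..} (\<lambda>t. q ^ k * Z * E * \<bar>exp (- (N * t)) * f t\<bar>)"
    "set_integrable lborel {0..} (\<lambda>t. L t * f t)"
    "set_integrable lborel {0..} (\<lambda>t. f x * L t)"
    by (intro set_integrable_mult_right set_integrable_abs Li i2 fN fi[folded L_def])+
  have "(LBINT t:{0..}. L t * f t) - f x * (Z / n) = (LBINT t:{0..}. L t * f t - f x * L t)"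
    using i3 LZ by (simp add: set_integral_diff)
  also have "\<bar>\<dots>\<bar> \<le> (LBINT t:{0..}. \<bar>L t * f t - f x * L t\<bar>)"
    using set_integral_norm_bound[OF set_integral_diff(1)[OF i3(4,5)]] by simp
  also have "\<dots> \<le> (LBINT t:{0..}. e * L t + D * (L t * (t - x)\<^sup>2) + q ^ k * Z * E * \<bar>exp (- (N * t)) * f t\<bar>)"
  proof (intro set_integral_mono set_integrable_abs set_integral_diff set_integral_add i3)
    fix t :: real assume "t \<in> {0..}"
    then have t: "0 \<le> t" by simp
    have "\<bar>L t * f t - f x * L t\<bar> = L t * \<bar>f t - f x\<bar>"
    proof -
      have "L t * f t - f x * L t = L t * (f t - f x)" by (simp add: algebra_simps)
      then show ?thesis using Lnn[OF t] by (simp add: abs_mult)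
    qed
    also have "\<dots> \<le> L t * (e + D * (t - x)\<^sup>2 + indicator {R<..} t * \<bar>f t\<bar>)"
      by (intro mult_left_mono fx t Lnn)
    also have "\<dots> = e * L t + D * (L t * (t - x)\<^sup>2) + L t * (indicator {R<..} t * \<bar>f t\<bar>)"
      by (simp add: algebra_simps)
    finally show "\<bar>L t * f t - f x * L t\<bar>
      \<le> e * L t + D * (L t * (t - x)\<^sup>2) + q ^ k * Z * E * \<bar>exp (- (N * t)) * f t\<bar>"
      using tail[OF t] by linarith
  qed
  also have "\<dots> = e * (Z / n) + D * (LBINT t:{0..}. L t * (t - x)\<^sup>2) + q ^ k * Z * E * F"
    using i3 by (simp add: set_integral_add LZ F_def)
  also have "\<dots> \<le> e * (Z / n) + D * (S * Z / n / (real n)\<^sup>2) + q ^ k * Z * E * F"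
    using mult_left_mono[OF L2 D] by simp
  \<comment> \<open>Dividing by the kernel's integral Z / n is what puts the factor n on the tail
    term.\<close>
  also have "\<dots> = (e + D / (real n)\<^sup>2 * S + n * E * F * q ^ k) * (Z / n)"
    using n' by (simp add: field_simps)
  finally have main: "\<bar>(LBINT t:{0..}. L t * f t) - f x * (Z / n)\<bar>
      \<le> (e + D / (real n)\<^sup>2 * S + n * E * F * q ^ k) * (Z / n)" .
  have Zn: "0 < Z / n" using Z n' by simp
  have "\<bar>(LBINT t:{0..}. L t * f t) / (Z / n) - f x\<bar>
      = \<bar>(LBINT t:{0..}. L t * f t) - f x * (Z / n)\<bar> / (Z / n)"
  proof -
    have "(LBINT t:{0..}. L t * f t) / (Z / n) - f x = ((LBINT t:{0..}. L t * f t) - f x * (Z / n)) / (Z / n)"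
      using Zn by (simp only: diff_divide_distrib nonzero_mult_div_cancel_right[OF less_imp_neq[OF Zn, symmetric]])
    then show ?thesis by (simp only: abs_divide[of _ "Z / n"] abs_of_pos[OF Zn])
  qed
  also have "\<dots> \<le> e + D / (real n)\<^sup>2 * S + n * E * F * q ^ k"
    using main Zn by (simp only: pos_divide_le_eq)
  finally show ?thesis
    using LZ unfolding half_line_inner_def L_def E_def F_def S_def by simp
qed

text \<open>Since the weights sum to 1, the error is the average of a_j - v. Averaging replaces the
  squared deviation by y / (1 - b) and q^j by exp (l y).\<close>

lemma gpois_average_error:
  fixes a :: "nat \<Rightarrow> real"
  assumes b: "0 \<le> b" "b < 1" and q: "0 \<le> q" "0 \<le> l" "q * exp (l * b) \<le> 1 + l" and y: "0 \<le> y"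
    and nn: "0 \<le> B" "0 \<le> T"
    and s: "summable (\<lambda>j. a j * gpois b j y)"
    and bound: "\<And>j. \<bar>a j - v\<bar> \<le> e + B * (1 + y + (real j * (1 - b) - y)\<^sup>2) + T * q ^ j"
  shows "\<bar>(\<Sum>j. a j * gpois b j y) - v\<bar> \<le> e + B * (1 + y + y / (1 - b)) + T * exp (l * y)"
proof -
  note p1 = gpois_sums_1[OF b y]
  have p0: "0 \<le> gpois b j y" for j using b y by (simp add: gpois_nonneg)
  have m2: "summable (\<lambda>j. (real j * (1 - b) - y)\<^sup>2 * gpois b j y)"
      "(\<Sum>j. (real j * (1 - b) - y)\<^sup>2 * gpois b j y) \<le> y / (1 - b)"
    using gpois_second_moment_partial[OF b y, of y] p0
    by (intro nonneg_partial_sums_bounded, auto)+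
  have mq: "summable (\<lambda>j. q ^ j * gpois b j y)" "(\<Sum>j. q ^ j * gpois b j y) \<le> exp (l * y)"
    using gpois_sum_power_le[OF b(1) q y] p0 q by (intro nonneg_partial_sums_bounded, auto)+
  let ?w = "\<lambda>j. (e + B * (1 + y)) * gpois b j y + B * ((real j * (1 - b) - y)\<^sup>2 * gpois b j y)
      + T * (q ^ j * gpois b j y)"
  have w: "?w sums ((e + B * (1 + y)) * 1 + B * (\<Sum>j. (real j * (1 - b) - y)\<^sup>2 * gpois b j y)
      + T * (\<Sum>j. q ^ j * gpois b j y))"
    using m2 mq by (intro sums_add sums_mult p1 summable_sums)
  have "(\<lambda>j. a j * gpois b j y - v * gpois b j y) sums ((\<Sum>j. a j * gpois b j y) - v * 1)"
    using s by (intro sums_diff sums_mult p1 summable_sums)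
  then have diff: "(\<Sum>j. a j * gpois b j y) - v = (\<Sum>j. a j * gpois b j y - v * gpois b j y)"
    by (simp add: sums_iff)
  have "\<bar>(\<Sum>j. a j * gpois b j y) - v\<bar> \<le> suminf ?w"
  proof -
    have "norm (a j * gpois b j y - v * gpois b j y) \<le> ?w j" for j
    proof -
      have "norm (a j * gpois b j y - v * gpois b j y) = \<bar>a j - v\<bar> * gpois b j y"
        using p0[of j] by (simp add: abs_mult flip: left_diff_distrib)
      also have "\<dots> \<le> (e + B * (1 + y + (real j * (1 - b) - y)\<^sup>2) + T * q ^ j) * gpois b j y"
        by (intro mult_right_mono bound p0)
      finally show ?thesis by (simp add: algebra_simps)
    qed
    from norm_suminf_le[OF this sums_summable[OF w]] show ?thesis
      unfolding diff real_norm_def .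
  qed
  also note sums_unique[OF w, symmetric]
  also have "(e + B * (1 + y)) * 1 + B * (\<Sum>j. (real j * (1 - b) - y)\<^sup>2 * gpois b j y)
      + T * (\<Sum>j. q ^ j * gpois b j y) \<le> (e + B * (1 + y)) * 1 + B * (y / (1 - b)) + T * exp (l * y)"
    by (intro add_mono order_refl mult_left_mono[OF m2(2)] mult_left_mono[OF mq(2)] nn)
  finally show ?thesis by (simp add: algebra_simps)
qed

lemma phillips_op_error:
  fixes f :: "real \<Rightarrow> real"
  assumes b: "0 \<le> b" "b < 1" and n: "0 < n" and x: "0 \<le> x"
    and df: "phillips_defined b n f x"
    and ql: "1 < q" "0 \<le> l" "q * exp (l * b) \<le> 1 + l" and N: "N \<le> (1 - 1 / q) * real n"
    and fN: "set_integrable lborel {0..} (\<lambda>t. exp (- (N * t)) * f t)"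
    and D: "0 \<le> D" and e: "0 \<le> e" and R: "0 \<le> R"
    and fx: "\<And>t. 0 \<le> t \<Longrightarrow> \<bar>f t - f x\<bar> \<le> e + D * (t - x)\<^sup>2 + indicator {R<..} t * \<bar>f t\<bar>"
  shows "\<bar>phillips_op b n f x - f x\<bar>
    \<le> e + 12 / (1 - b) * D / (real n)\<^sup>2 * (1 + real n * x + real n * x / (1 - b))
      + real n * exp (- (((1 - 1 / q) * real n - N) * R)) * (LBINT t:{0..}. \<bar>exp (- (N * t)) * f t\<bar>)
        * exp (l * (real n * x))"
proof -
  define y where "y = real n * x"
  define G where "G = 1 / (1 - b)"
  define T where "T = real n * exp (- (((1 - 1 / q) * real n - N) * R)) * (LBINT t:{0..}. \<bar>exp (- (N * t)) * f t\<bar>)"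
  \<comment> \<open>Including f 0 as the coefficient of the zeroth weight turns the operator into
    one average. The kernel index lags by one: the weight of index k + 1 carries the coefficient
    formed with kernel k.\<close>
  define a where "a j = (case j of 0 \<Rightarrow> f 0 | Suc k \<Rightarrow>
    half_line_inner (jain_basis b n k) f / half_line_inner (jain_basis b n k) (\<lambda>_. 1))" for j
  have n': "0 < real n" and y: "0 \<le> y" using n x by (auto simp: y_def)
  have G: "1 \<le> G" using b by (simp add: G_def)
  have T: "0 \<le> T"
    unfolding T_def set_lebesgue_integral_def by (intro mult_nonneg_nonneg Bochner_Integration.integral_nonneg) auto
  have aS: "a (Suc k) * gpois b (Suc k) y = phillips_term b n f x k" for k
    by (simp add: a_def y_def phillips_term_def jain_basis_eq_gpois)
  have sm: "summable (\<lambda>k. a (Suc k) * gpois b (Suc k) y)"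
    using df by (simp add: aS phillips_defined_def)
  then have s: "summable (\<lambda>j. a j * gpois b j y)"
    by (simp add: summable_Suc_iff[of "\<lambda>j. a j * gpois b j y"])
  have op: "phillips_op b n f x = (\<Sum>j. a j * gpois b j y)"
  proof -
    have "a 0 * gpois b 0 y = exp (- (real n * x)) * f 0"
      by (simp add: a_def y_def)
    moreover have "(\<Sum>k. phillips_term b n f x k) = (\<Sum>j. a j * gpois b j y) - a 0 * gpois b 0 y"
      using suminf_split_head[OF s] by (simp only: aS)
    ultimately show ?thesis by (simp only: phillips_op_def)
  qed
  have "\<bar>(\<Sum>j. a j * gpois b j y) - f x\<bar>
    \<le> e + 12 * G * D / (real n)\<^sup>2 * (1 + y + y / (1 - b)) + T * exp (l * y)"
  proof (rule gpois_average_error[OF b _ ql(2,3) y _ T s])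
    show "0 \<le> q" using ql by simp
    show "0 \<le> 12 * G * D / (real n)\<^sup>2" using G D by simp
    fix j
    show "\<bar>a j - f x\<bar> \<le> e + 12 * G * D / (real n)\<^sup>2 * (1 + y + (real j * (1 - b) - y)\<^sup>2) + T * q ^ j"
    proof (cases j)
      case 0
      have "\<bar>f 0 - f x\<bar> \<le> e + D * x\<^sup>2"
        using fx[of 0] R by simp
      also have "D * x\<^sup>2 = D / (real n)\<^sup>2 * (1 * y\<^sup>2)"
        using n' by (simp add: y_def power_mult_distrib)
      also have "\<dots> \<le> D / (real n)\<^sup>2 * (12 * G * (1 + y + y\<^sup>2))"
        using G D y by (intro mult_left_mono mult_mono) auto
      finally show ?thesis using T by (simp add: 0 a_def mult_ac)
    next
      case (Suc k)
      define w where "w = real j * (1 - b) - y"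
      have kw: "real k * (1 - b) - y = w - (1 - b)" by (simp add: w_def Suc algebra_simps)
      \<comment> \<open>Each of the three summands is at most 4 G (1 + y + w^2), hence the 12. For
        the first, k \<le> j = G (w + y) and w \<le> 1 + w^2.\<close>
      have "4 * real k + 4 / (1 - b) + 2 * (real k * (1 - b) - y)\<^sup>2 \<le> 12 * G * (1 + y + w\<^sup>2)"
      proof -
        have "2 * w \<le> 1 + w\<^sup>2"
          using zero_le_power2[of "w - 1"] by (simp add: power2_eq_square algebra_simps)
        then have w1: "w \<le> 1 + w\<^sup>2" using zero_le_power2[of w] by linarith
        have "real j = G * (w + y)" using b by (simp add: G_def w_def)
        also have "\<dots> \<le> G * (1 + y + w\<^sup>2)" using G w1 by (intro mult_left_mono) auto
        finally have k: "real k \<le> G * (1 + y + w\<^sup>2)" by (simp add: Suc)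
        have "(1 - b)\<^sup>2 \<le> 1" using b by (simp add: power_le_one)
        then have "2 * (w - (1 - b))\<^sup>2 \<le> 4 * (1 + w\<^sup>2)"
          using zero_le_power2[of "w + (1 - b)"] by (simp add: power2_eq_square algebra_simps)
        also have "\<dots> \<le> 4 * (G * (1 + y + w\<^sup>2))"
          using G y mult_mono[of 1 G "1 + w\<^sup>2" "1 + y + w\<^sup>2"] by simp
        finally have sq: "2 * (w - (1 - b))\<^sup>2 \<le> 4 * (G * (1 + y + w\<^sup>2))" .
        have "G \<le> G * (1 + y + w\<^sup>2)" using G y by (simp add: mult_le_cancel_left1)
        then have "4 * real k + 4 * G + 2 * (w - (1 - b))\<^sup>2 \<le> 12 * (G * (1 + y + w\<^sup>2))"
          using k sq by linarith
        then show ?thesis unfolding kw by (simp add: G_def)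
      qed
      then have "D / (real n)\<^sup>2 * (4 * real k + 4 / (1 - b) + 2 * (real k * (1 - b) - y)\<^sup>2)
          \<le> D / (real n)\<^sup>2 * (12 * G * (1 + y + w\<^sup>2))"
        using D by (intro mult_left_mono) auto
      moreover have "T * q ^ k \<le> T * q ^ j"
        using T ql by (intro mult_left_mono power_increasing) (auto simp: Suc)
      moreover have "\<bar>a j - f x\<bar> \<le> e + D / (real n)\<^sup>2 * (4 * real k + 4 / (1 - b) + 2 * (real k * (1 - b) - y)\<^sup>2) + T * q ^ k"
        using phillips_coefficient_error[OF b n _ ql(1) N fN D e fx, of k] df
        by (simp add: a_def Suc T_def y_def phillips_defined_def)
      ultimately show ?thesis by (simp add: w_def mult_ac)
    qed
  qed
  then show ?thesis by (simp add: op T_def G_def y_def)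
qed

text \<open>Definedness is asked only for large n: exp (c t), for instance, already fails the k = 0
  integrability clause when n \<le> c.\<close>

theorem mainTheorem3:
  fixes \<beta> a b :: real and f :: "real \<Rightarrow> real"
  assumes "0 \<le> \<beta>" and "\<beta> < 1"
    and "continuous_on {0..} f"
    and "0 \<le> a" and "a \<le> b"
    and "\<forall>\<^sub>F n in sequentially. \<forall>x\<in>{a..b}. phillips_defined \<beta> n f x"
  shows "uniform_limit {a..b} (\<lambda>n x. phillips_op \<beta> n f x) f sequentially"
proof (rule uniform_limitI)
  fix e :: real assume "0 < e"
  then have e: "0 < e / 2" by simp
  obtain N where N: "0 < N" "\<And>n x. \<lbrakk>N \<le> n; x \<in> {a..b}\<rbrakk> \<Longrightarrow> phillips_defined \<beta> n f x"
  proof -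
    obtain M where "\<forall>n\<ge>M. \<forall>x\<in>{a..b}. phillips_defined \<beta> n f x"
      using assms(6) unfolding eventually_sequentially by blast
    \<comment> \<open>\<open>Suc M\<close> makes N positive, so every n \<ge> N is a positive
      index.\<close>
    then show thesis by (intro that[of "Suc M"]) auto
  qed
  \<comment> \<open>The zeroth kernel is exp (- N t), and a \<le> b supplies a point of the interval
    at which definedness can be used.\<close>
  have "set_integrable lborel {0..} (\<lambda>t. jain_basis \<beta> N 0 t * f t)"
    using N(2)[of N a] assms(5) by (simp add: phillips_defined_def)
  then have fN: "set_integrable lborel {0..} (\<lambda>t. exp (- (real N * t)) * f t)"
    by (simp add: jain_basis_def)
  obtain q l :: real where ql: "1 < q" "0 < l" "q * exp (l * \<beta>) \<le> 1 + l"
    by (rule exists_exponential_rate[OF assms(1,2)])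
  define \<kappa> where "\<kappa> = 1 - 1 / q"
  have \<kappa>: "0 < \<kappa>" using ql by (simp add: \<kappa>_def)
  have b: "0 \<le> b" using assms by simp
  \<comment> \<open>The first entry is required by the quadratic modulus. The second gives \<kappa>
    R - l b \<ge> 1, so that tail decay beats the growth exp (l n b) by a factor exp (- n).\<close>
  define R where "R = max (b + 1) ((l * b + 1) / \<kappa>)"
  have R: "b + 1 \<le> R" "0 \<le> R" using b by (auto simp: R_def)
  have "(l * b + 1) / \<kappa> \<le> R" by (simp add: R_def)
  then have \<kappa>R: "l * b + 1 \<le> \<kappa> * R" using \<kappa> by (simp add: field_simps)
  obtain D where D: "0 \<le> D" "\<forall>x\<in>{0..b}. \<forall>t\<ge>0.
    \<bar>f t - f x\<bar> \<le> e / 2 + D * (t - x)\<^sup>2 + indicator {R<..} t * \<bar>f t\<bar>"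
    using continuous_half_line_quadratic_modulus[OF assms(3) e R(1) b] by blast
  define F where "F = (LBINT t:{0..}. \<bar>exp (- (real N * t)) * f t\<bar>)"
  define C where "C = 12 / (1 - \<beta>) * D"
  \<comment> \<open>These are the two error terms depending on n, with x replaced by its largest
    value b; this makes the estimate uniform.\<close>
  define \<epsilon> where "\<epsilon> n = C * ((1 + n * (b + b / (1 - \<beta>))) / n\<^sup>2) + F * exp (N * R) * (n * exp (- n))" for n :: real
  have F0: "0 \<le> F"
    unfolding F_def set_lebesgue_integral_def by (intro Bochner_Integration.integral_nonneg) auto
  have C0: "0 \<le> C" using D assms by (simp add: C_def)
  have bound: "\<bar>phillips_op \<beta> n f x - f x\<bar> \<le> e / 2 + \<epsilon> n"
    if n: "N \<le> n" "N \<le> \<kappa> * real n" and x: "x \<in> {a..b}" for n x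
  proof -
    have n0: "0 < n" and x0: "0 \<le> x" "x \<le> b" using n x N assms by auto
    have nx: "n * x \<le> n * b" using x0 by (intro mult_left_mono) auto
    have "\<bar>phillips_op \<beta> n f x - f x\<bar>
      \<le> e / 2 + C / (real n)\<^sup>2 * (1 + real n * x + real n * x / (1 - \<beta>))
        + real n * exp (- ((\<kappa> * real n - N) * R)) * F * exp (l * (real n * x))"
      unfolding C_def F_def \<kappa>_def
    proof (rule phillips_op_error[OF assms(1,2) n0 x0(1) _ ql(1) _ ql(3) _ fN D(1) _ R(2)])
      show "phillips_defined \<beta> n f x" by (rule N(2)[OF n(1) x])
      show "real N \<le> (1 - 1 / q) * real n" using n(2) by (simp only: \<kappa>_def)
      show "\<bar>f t - f x\<bar> \<le> e / 2 + D * (t - x)\<^sup>2 + indicator {R<..} t * \<bar>f t\<bar>" if "0 \<le> t" for t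
        using D(2) x0 that by simp
    qed (use ql e in auto)
    also have "\<dots> \<le> e / 2 + C / (real n)\<^sup>2 * (1 + n * b + n * b / (1 - \<beta>))
        + real n * exp (- ((\<kappa> * real n - N) * R)) * F * exp (l * (real n * b))"
      using nx x0 C0 F0 ql assms(2) by (intro add_mono mult_left_mono divide_right_mono) auto
    also have "real n * exp (- ((\<kappa> * real n - N) * R)) * F * exp (l * (real n * b))
        = F * exp (N * R) * (real n * exp (- real n * (\<kappa> * R - l * b)))"
      by (simp add: algebra_simps flip: exp_add)
    also have "\<dots> \<le> F * exp (N * R) * (real n * exp (- real n))"
    proof -
      have "real n * 1 \<le> real n * (\<kappa> * R - l * b)" using \<kappa>R by (intro mult_left_mono) auto
      then show ?thesis using F0 by (intro mult_left_mono) auto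
    qed
    finally show ?thesis by (simp add: \<epsilon>_def distrib_left add_divide_distrib add_ac mult_ac)
  qed
  have "((\<lambda>n::real. (1 + n * c) / n\<^sup>2) \<longlongrightarrow> 0) at_top" for c by real_asymp
  moreover have "((\<lambda>n::real. n * exp (- n)) \<longlongrightarrow> 0) at_top" by real_asymp
  ultimately have "(\<epsilon> \<longlongrightarrow> C * 0 + F * exp (N * R) * 0) at_top"
    unfolding \<epsilon>_def by (intro tendsto_intros)
  then have "((\<lambda>n. \<epsilon> (real n)) \<longlongrightarrow> 0) sequentially"
    by (auto intro: filterlim_compose[OF _ filterlim_real_sequentially])
  then have ev: "\<forall>\<^sub>F n in sequentially. \<epsilon> (real n) < e / 2"
    using e by (intro order_tendstoD) auto
  \<comment> \<open>For such n the tilted decay rate \<kappa> n is at least N, as the splitting of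
    the tail exponent demands.\<close>
  have ev2: "\<forall>\<^sub>F n in sequentially. real N / \<kappa> \<le> real n"
    using filterlim_real_sequentially by (auto simp: filterlim_at_top)
  show "\<forall>\<^sub>F n in sequentially. \<forall>x\<in>{a..b}. dist (phillips_op \<beta> n f x) (f x) < e"
    using ev ev2 eventually_ge_at_top[of N]
  proof eventually_elim
    case (elim n)
    have "N \<le> \<kappa> * real n" using elim(2) \<kappa> by (simp add: field_simps)
    then show ?case using bound[OF elim(3)] elim(1) by (force simp: dist_real_def)
  qed
qed

end
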